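(* Let $\mathcal{P}=(\mathcal{E},D,c,f_c)$ be a Minimum Spanning Tree Problem on a connected undirected graph and $E=\{e_1,e_2,\dots,e_k\}\subseteq\mathcal{E}$. Then $\sum_{i=1}^k u'_{\mathcal{P}}(e_i)\le u'_{\mathcal{P}}(E)$.
   Context: Let $\Gamma$ be a connected undirected graph with weight function $c:E(\Gamma)\to\mathbb{R}$. The Minimum Spanning Tree Problem (MSTP) is the combinatorial sum problem $\mathcal{P}=(\mathcal{E},D,c,f_c)$ with $\mathcal{E}=E(\Gamma)$, $D$ the set of spanning trees of $\Gamma$ and $f_c(T)=\sum_{e\in E(T)}c(e)$; a minimum spanning tree (MST) minimizes $f_c$. For $E=\{e_1,\dots,e_k\}$ and $\vec\alpha\in\mathbb{R}^k$, $\mathcal{P}_{c_{\vec\alpha,E}}$ is the problem with the cost of $e_i$ changed to $c(e_i)+\alpha_i$ and all other costs unchanged; $\mathcal{P}_{c_{\alpha,e}}$ is the analogue for a single edge. Single upper tolerance: $u'_{\mathcal{P}}(e)=\max\{\alpha\ge0:$ each MST of $\mathcal{P}$ is an MST of $\mathcal{P}_{c_{\alpha,e}}\}$. Set upper tolerance: $u'_{\mathcal{P}}(E)=\max\{\alpha\in\mathbb{R}:$ for each MST $T^\ast$ of $\mathcal{P}$ there exists $\vec\alpha=(\alpha_1,\dots,\alpha_k)$ with all $\alpha_i\ge0$, $\alpha=\sum_i\alpha_i$, such that $T^\ast$ is an MST of $\mathcal{P}_{c_{\vec\alpha,E}}\}$. Tolerances take the value $\infty$ when the set is unbounded. *)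

theory Defs
  imports Complex_Main "HOL-Library.Extended_Real"
begin

section \<open>Finite simple graphs and spanning trees\<close>

text \<open>A graph is a vertex set \<open>V\<close> with a set \<open>G\<close> of edges, each edge being a two-element
  set of vertices.\<close>

definition simple_graph :: "'v set \<Rightarrow> 'v set set \<Rightarrow> bool" where
  "simple_graph V G \<longleftrightarrow>
     finite V \<and> V \<noteq> {} \<and> (\<forall>e\<in>G. \<exists>u\<in>V. \<exists>v\<in>V. u \<noteq> v \<and> e = {u, v})"

definition connected_graph :: "'v set \<Rightarrow> 'v set set \<Rightarrow> bool" where
  "connected_graph V G \<longleftrightarrow> (\<forall>u\<in>V. \<forall>v\<in>V. (u, v) \<in> {(x, y). {x, y} \<in> G}\<^sup>*)"

text \<open>A cycle is given by its vertices in cyclic order, without repeating the first one.\<close>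

definition is_cycle :: "'v set set \<Rightarrow> 'v list \<Rightarrow> bool" where
  "is_cycle G vs \<longleftrightarrow> distinct vs \<and> 3 \<le> length vs \<and>
     (\<forall>i<length vs. {vs ! i, vs ! (Suc i mod length vs)} \<in> G)"

definition acyclic_graph :: "'v set set \<Rightarrow> bool" where
  "acyclic_graph G \<longleftrightarrow> (\<nexists>vs. is_cycle G vs)"

text \<open>A spanning tree is identified with its edge set.\<close>

definition spanning_trees :: "'v set \<Rightarrow> 'v set set \<Rightarrow> 'v set set set" where
  "spanning_trees V G = {T. T \<subseteq> G \<and> connected_graph V T \<and> acyclic_graph T}"


section \<open>Combinatorial sum problems and upper tolerances\<close>

text \<open>\<open>D\<close> is the set of feasible solutions, each a set of ground elements, and \<open>c\<close> is the
  cost function.\<close>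

definition total_cost :: "('e \<Rightarrow> real) \<Rightarrow> 'e set \<Rightarrow> real" where
  "total_cost c S = (\<Sum>e\<in>S. c e)"

definition optimal_solutions :: "'e set set \<Rightarrow> ('e \<Rightarrow> real) \<Rightarrow> 'e set set" where
  "optimal_solutions D c = {S \<in> D. \<forall>S'\<in>D. total_cost c S \<le> total_cost c S'}"

text \<open>A vector \<open>(\<alpha>\<^sub>1, \<dots>, \<alpha>\<^sub>k)\<close> attached to \<open>E = {e\<^sub>1, \<dots>, e\<^sub>k}\<close> is a function on
  the elements; its values outside \<open>E\<close> play no role.\<close>

definition raise_costs :: "('e \<Rightarrow> real) \<Rightarrow> 'e set \<Rightarrow> ('e \<Rightarrow> real) \<Rightarrow> 'e \<Rightarrow> real" where
  "raise_costs c E \<alpha> = (\<lambda>e. if e \<in> E then c e + \<alpha> e else c e)"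

text \<open>\<open>Max\<close> only applies to finite sets, hence \<open>Greatest\<close>, which is meaningful when the
  maximum is attained. A tolerance set contains \<open>0\<close>, so it is never empty.\<close>

definition max_or_infinity :: "real set \<Rightarrow> ereal" where
  "max_or_infinity A = (if bdd_above A then ereal (GREATEST \<alpha>. \<alpha> \<in> A) else \<infinity>)"

definition upper_tolerance :: "'e set set \<Rightarrow> ('e \<Rightarrow> real) \<Rightarrow> 'e \<Rightarrow> ereal" where
  "upper_tolerance D c e = max_or_infinity
     {\<alpha>. 0 \<le> \<alpha> \<and>
        (\<forall>S\<in>optimal_solutions D c. S \<in> optimal_solutions D (c(e := c e + \<alpha>)))}"

definition set_upper_tolerance :: "'e set set \<Rightarrow> ('e \<Rightarrow> real) \<Rightarrow> 'e set \<Rightarrow> ereal" where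
  "set_upper_tolerance D c E = max_or_infinity
     {\<alpha>. \<forall>S\<in>optimal_solutions D c. \<exists>\<alpha>s.
        (\<forall>e\<in>E. 0 \<le> \<alpha>s e) \<and> \<alpha> = (\<Sum>e\<in>E. \<alpha>s e) \<and>
        S \<in> optimal_solutions D (raise_costs c E \<alpha>s)}"

end

theory Submission
  imports Defs "HOL-Analysis.Function_Topology" "HOL-Library.Transitive_Closure_Table"
begin

text \<open>A spanning tree \<open>T\<close> is minimum as soon as \<open>c e \<le> c f\<close> for every single exchange of
  an edge \<open>e\<close> of \<open>T\<close> for an edge \<open>f\<close> outside \<open>T\<close>. If \<open>T\<close> stays minimum when the cost of one
  edge \<open>e \<in> E\<close> is raised by its tolerance \<open>u e\<close>, these inequalities hold even with
  \<open>c e + u e\<close> in place of \<open>c e\<close>; raising the costs of the \<open>f\<close> as well only helps. So every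
  minimum spanning tree survives the simultaneous raise by all the tolerances. That a bounded
  tolerance set has a maximum is a compactness argument: nonnegative vectors with bounded sum
  lie in a box.\<close>

section \<open>Reachability in a graph given by its edges\<close>

definition reach :: "'v set set \<Rightarrow> ('v \<times> 'v) set" where
  "reach G = {(x, y). {x, y} \<in> G}\<^sup>*"

lemma connected_graph_iff: "connected_graph V G \<longleftrightarrow> (\<forall>u\<in>V. \<forall>v\<in>V. (u, v) \<in> reach G)"
  by (simp add: connected_graph_def reach_def)

lemma reach_refl [simp]: "(u, u) \<in> reach G"
  by (simp add: reach_def)

lemma reach_sym: "(u, v) \<in> reach G \<Longrightarrow> (v, u) \<in> reach G"
  unfolding reach_def by (rule symD[OF sym_rtrancl]) (auto simp: sym_def insert_commute)

lemma reach_edge: "{x, y} \<in> G \<Longrightarrow> (x, y) \<in> reach G"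
  by (auto simp: reach_def)

lemma reach_mono: "G \<subseteq> H \<Longrightarrow> (u, v) \<in> reach G \<Longrightarrow> (u, v) \<in> reach H"
  unfolding reach_def by (rule subsetD[OF rtrancl_mono]) auto

lemma reach_trans: "(u, v) \<in> reach G \<Longrightarrow> (v, w) \<in> reach G \<Longrightarrow> (u, w) \<in> reach G"
  unfolding reach_def by (rule rtrancl_trans)

lemma reach_induct [consumes 1, case_names refl step]:
  assumes "(u, v) \<in> reach G" and "P u"
    and "\<And>w z. \<lbrakk>(u, w) \<in> reach G; {w, z} \<in> G; P w\<rbrakk> \<Longrightarrow> P z"
  shows "P v"
  using assms(1) unfolding reach_def
  by (induction rule: rtrancl_induct) (use assms(2,3) in \<open>auto simp: reach_def\<close>)

text \<open>Each crossing of the edge \<open>{x, y}\<close> is replaced by a walk from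
  \<open>x\<close> to \<open>y\<close> in \<open>H\<close>, or by its reverse.\<close>

lemma reach_replace_edge:
  assumes "(u, v) \<in> reach G" and "G \<subseteq> insert {x, y} H" and xy: "(x, y) \<in> reach H"
  shows "(u, v) \<in> reach H"
  using assms(1)
proof (induction rule: reach_induct)
  case (step w z)
  have "(w, z) \<in> reach H"
  proof (cases "{w, z} = {x, y}")
    case True
    then show ?thesis using xy reach_sym[OF xy] by (auto simp: doubleton_eq_iff)
  next
    case False
    then show ?thesis using step.hyps assms(2) by (intro reach_edge) auto
  qed
  with step.IH show ?case by (rule reach_trans)
qed simp

lemma connected_graph_replace_edge:
  assumes "connected_graph V G" "G \<subseteq> insert {x, y} H" "(x, y) \<in> reach H"
  shows "connected_graph V H"
  using assms reach_replace_edge[of _ _ G x y H] by (simp add: connected_graph_iff)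

text \<open>Cut the walk before its first and after its last crossing of the edge. Crossings in the
  same direction give one of the last two cases; for opposite directions the two pieces meet, which
  gives the first.\<close>

lemma reach_delete_edge_cases:
  assumes "(u, w) \<in> reach G"
  shows "(u, w) \<in> reach (G - {{x, y}}) \<or>
    (u, x) \<in> reach (G - {{x, y}}) \<and> (y, w) \<in> reach (G - {{x, y}}) \<or>
    (u, y) \<in> reach (G - {{x, y}}) \<and> (x, w) \<in> reach (G - {{x, y}})"
  using assms
proof (induction rule: reach_induct)
  case (step w z)
  show ?case
  proof (cases "{w, z} = {x, y}")
    case True
    then show ?thesis using step.IH by (auto simp: doubleton_eq_iff)
  next
    case False
    then have "(w, z) \<in> reach (G - {{x, y}})" using step.hyps by (intro reach_edge) auto
    then show ?thesis using step.IH reach_trans by metis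
  qed
qed simp

section \<open>Spanning trees and edge exchange\<close>

text \<open>A walk avoiding the edge could be shortened to a path, which the edge would close to a
  cycle.\<close>

lemma acyclic_graph_delete_edge:
  assumes ac: "acyclic_graph T" and e: "{u, v} \<in> T" and "u \<noteq> v"
  shows "(u, v) \<notin> reach (T - {{u, v}})"
proof
  let ?H = "T - {{u, v}}" and ?r = "\<lambda>x y. {x, y} \<in> T - {{u, v}}"
  assume "(u, v) \<in> reach ?H"
  then have "?r\<^sup>*\<^sup>* u v" by (simp only: reach_def rtranclp_rtrancl_eq)
  then obtain xs0 where "rtrancl_path ?r u xs0 v" by (auto simp: rtranclp_eq_rtrancl_path)
  then obtain xs where p: "rtrancl_path ?r u xs v" and d: "distinct (u # xs)"
    by (rule rtrancl_path_distinct)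
  have "xs \<noteq> []" using p \<open>u \<noteq> v\<close> by (auto elim: rtrancl_path.cases)
  then have last: "last xs = v" using p by (simp add: rtrancl_path_last)
  have edge: "{(u # xs) ! i, xs ! i} \<in> ?H" if "i < length xs" for i
    using rtrancl_path_nth[OF p that] .
  \<comment> \<open>A path of one step would be the deleted edge itself, so the cycle has at least
    three vertices.\<close>
  have "length xs \<noteq> 1"
    using edge[of 0] last by (cases xs) auto
  then have len: "3 \<le> length (u # xs)" using \<open>xs \<noteq> []\<close> by (cases xs; cases "tl xs") auto
  have "{(u # xs) ! i, (u # xs) ! (Suc i mod length (u # xs))} \<in> T" if "i < length (u # xs)" for i
  proof (cases "i = length xs")
    case True
    then have "(u # xs) ! i = v" using last \<open>xs \<noteq> []\<close> by (simp add: last_conv_nth nth_Cons')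
    then show ?thesis using True e by (simp add: insert_commute)
  next
    case False
    then show ?thesis using that edge[of i] by simp
  qed
  then have "is_cycle T (u # xs)" using d len by (simp add: is_cycle_def)
  with ac show False by (auto simp: acyclic_graph_def)
qed

text \<open>The edge chosen is the one that closes the vertex list; the other edges lead from the
  first vertex to the last.\<close>

lemma cycle_delete_edge:
  assumes "is_cycle T vs"
  obtains x y where "{x, y} \<in> T" "(x, y) \<in> reach (T - {{x, y}})"
proof
  let ?n = "length vs" and ?x = "vs ! 0" and ?y = "vs ! (length vs - 1)"
  have d: "distinct vs" and n: "3 \<le> ?n"
    and edge: "\<And>i. i < ?n \<Longrightarrow> {vs ! i, vs ! (Suc i mod ?n)} \<in> T"
    using assms by (auto simp: is_cycle_def)
  have "vs \<noteq> []" using n by auto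
  have "(Suc (?n - 1)) mod ?n = 0" using n by (cases ?n) auto
  then show "{?x, ?y} \<in> T" using edge[of "?n - 1"] n by (simp add: insert_commute)
  have "(?x, vs ! i) \<in> reach (T - {{?x, ?y}})" if "i < ?n" for i
    using that
  proof (induction i)
    case (Suc i)
    \<comment> \<open>By distinctness, equality would make the first and last positions neighbours
      in the list, as in a cycle of two vertices.\<close>
    have "{vs ! i, vs ! Suc i} \<noteq> {?x, ?y}"
    proof
      assume "{vs ! i, vs ! Suc i} = {?x, ?y}"
      then have "vs ! i = ?x \<and> vs ! Suc i = ?y \<or> vs ! i = ?y \<and> vs ! Suc i = ?x"
        by (simp only: doubleton_eq_iff)
      moreover have "i < ?n" "0 < ?n" "?n - 1 < ?n" using Suc.prems n by linarith+
      ultimately have "i = 0 \<and> Suc i = ?n - 1 \<or> i = ?n - 1 \<and> Suc i = 0"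
        using Suc.prems by (simp only: nth_eq_iff_index_eq[OF d])
      then show False using n by linarith
    qed
    moreover have "{vs ! i, vs ! Suc i} \<in> T"
      using edge[of i] Suc.prems by simp
    ultimately have "(vs ! i, vs ! Suc i) \<in> reach (T - {{?x, ?y}})"
      by (intro reach_edge) blast
    with Suc.IH Suc_lessD[OF Suc.prems] show ?case by (blast intro: reach_trans)
  qed simp
  from this[of "?n - 1"] show "(?x, ?y) \<in> reach (T - {{?x, ?y}})" using n by simp
qed

lemma simple_graph_edgeE:
  assumes "simple_graph V G" "e \<in> G"
  obtains u v where "u \<in> V" "v \<in> V" "u \<noteq> v" "e = {u, v}"
  using assms unfolding simple_graph_def by blast

lemma simple_graph_finite: "simple_graph V G \<Longrightarrow> finite G"
  by (rule finite_subset[of _ "Pow V"]) (auto simp: simple_graph_def)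

text \<open>An edge closing a cycle can be deleted without disconnecting the graph; in an acyclic
  graph no edge can. With trees seen as minimal connected graphs, later arguments need no
  cycles.\<close>

lemma spanning_trees_iff:
  assumes "simple_graph V G"
  shows "T \<in> spanning_trees V G \<longleftrightarrow>
    T \<subseteq> G \<and> connected_graph V T \<and> (\<forall>e\<in>T. \<not> connected_graph V (T - {e}))"
proof (cases "T \<subseteq> G \<and> connected_graph V T")
  case True
  have "acyclic_graph T \<longleftrightarrow> (\<forall>e\<in>T. \<not> connected_graph V (T - {e}))"
  proof
    assume ac: "acyclic_graph T"
    show "\<forall>e\<in>T. \<not> connected_graph V (T - {e})"
    proof
      fix e assume "e \<in> T"
      with True obtain u v where uv: "u \<in> V" "v \<in> V" "u \<noteq> v" "e = {u, v}"
        using simple_graph_edgeE[OF assms] by blast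
      then show "\<not> connected_graph V (T - {e})"
        using acyclic_graph_delete_edge[OF ac, of u v] \<open>e \<in> T\<close>
        by (auto simp: connected_graph_iff)
    qed
  next
    assume min: "\<forall>e\<in>T. \<not> connected_graph V (T - {e})"
    show "acyclic_graph T"
      unfolding acyclic_graph_def
    proof
      assume "\<exists>vs. is_cycle T vs"
      then obtain vs where "is_cycle T vs" ..
      then obtain x y where "{x, y} \<in> T" "(x, y) \<in> reach (T - {{x, y}})"
        by (rule cycle_delete_edge)
      then have "connected_graph V (T - {{x, y}})"
        using True connected_graph_replace_edge[of V T x y "T - {{x, y}}"] by blast
      with min \<open>{x, y} \<in> T\<close> show False by blast
    qed
  qed
  with True show ?thesis by (simp add: spanning_trees_def)
qed (auto simp: spanning_trees_def)

text \<open>Deleting \<open>e\<close> cuts \<open>T\<close> into two sides; a path of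
  \<open>T'\<close> between the ends of \<open>e\<close> must cross the cut, and \<open>f\<close> is
  a crossing edge. \<open>T'\<close> is merely connected because the size comparison below applies
  this to graphs not known to be trees.\<close>

lemma connected_graph_exchange:
  assumes G: "simple_graph V G" and T: "T \<in> spanning_trees V G"
    and T': "T' \<subseteq> G" "connected_graph V T'" and e: "e \<in> T" "e \<notin> T'"
  obtains f where "f \<in> T'" "f \<notin> T"
    "connected_graph V (insert f (T - {e}))" "connected_graph V (insert e (T' - {f}))"
proof -
  have TG: "T \<subseteq> G" and Tc: "connected_graph V T" and min: "\<not> connected_graph V (T - {e})"
    using T e by (auto simp: spanning_trees_iff[OF G])
  obtain u v where uv: "u \<in> V" "v \<in> V" "e = {u, v}"
    using simple_graph_edgeE[OF G] e TG by blast
  have nuv: "(u, v) \<notin> reach (T - {e})"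
    using connected_graph_replace_edge[OF Tc, of u v "T - {e}"] min uv by blast
  \<comment> \<open>An inclusion-minimal member of \<open>C\<close> stands for a path from
    \<open>u\<close> to \<open>v\<close> in \<open>T'\<close>: each of its edges is
    essential.\<close>
  define C where "C = {P. P \<subseteq> T' \<and> (u, v) \<in> reach P}"
  have "finite C"
    using finite_subset[OF T'(1) simple_graph_finite[OF G]] by (simp add: C_def)
  moreover have "T' \<in> C"
    using T' uv by (simp add: C_def connected_graph_iff)
  ultimately obtain P where PC: "P \<in> C" and Pmin: "\<forall>Q\<in>C. Q \<subseteq> P \<longrightarrow> P = Q"
    using finite_has_minimal[of C] by auto
  then have P: "P \<subseteq> T'" "(u, v) \<in> reach P" by (simp_all add: C_def)
  \<comment> \<open>Otherwise every vertex reached from \<open>u\<close> in \<open>P\<close> would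
    lie on the side of \<open>u\<close>, including \<open>v\<close>.\<close>
  have "\<exists>x y. {x, y} \<in> P \<and> (u, x) \<in> reach (T - {e}) \<and> (u, y) \<notin> reach (T - {e})"
  proof (rule ccontr)
    assume no: "\<not> ?thesis"
    have "(u, w) \<in> reach (T - {e})" if "(u, w) \<in> reach P" for w
      using that
    proof (induction rule: reach_induct)
      case (step w z)
      with no show ?case by blast
    qed simp
    with P nuv show False by blast
  qed
  then obtain x y where xy: "{x, y} \<in> P" "(u, x) \<in> reach (T - {e})" "(u, y) \<notin> reach (T - {e})"
    by blast
  let ?f = "{x, y}"
  have fT': "?f \<in> T'" using xy P by blast
  moreover have fT: "?f \<notin> T"
  proof
    assume "?f \<in> T"
    then have "(x, y) \<in> reach (T - {e})" using e fT' by (intro reach_edge) auto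
    with xy show False using reach_trans by metis
  qed
  moreover have "connected_graph V (insert ?f (T - {e}))"
  proof (rule connected_graph_replace_edge[OF Tc])
    show "T \<subseteq> insert {u, v} (insert ?f (T - {e}))" using uv by auto
    obtain a b where "a \<in> V" "b \<in> V" "?f = {a, b}"
      using simple_graph_edgeE[OF G subsetD[OF T'(1) fT']] by blast
    then have "y \<in> V" by (auto simp: doubleton_eq_iff)
    then have "(u, y) \<in> reach T" using Tc uv by (simp add: connected_graph_iff)
    \<comment> \<open>\<open>y\<close> is not on the side of \<open>u\<close>, so a walk from
      \<open>u\<close> to \<open>y\<close> in \<open>T\<close> must cross \<open>e\<close>, and
      \<open>y\<close> is on the side of \<open>v\<close>.\<close>
    then have "(v, y) \<in> reach (T - {e})"
      using reach_delete_edge_cases[of u y T u v] xy(3) uv by auto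
    then have "(y, v) \<in> reach (insert ?f (T - {e}))"
      by (rule reach_mono[OF subset_insertI reach_sym])
    moreover have "(u, x) \<in> reach (insert ?f (T - {e}))"
      using xy(2) by (rule reach_mono[OF subset_insertI])
    moreover have "(x, y) \<in> reach (insert ?f (T - {e}))" by (rule reach_edge) simp
    ultimately show "(u, v) \<in> reach (insert ?f (T - {e}))" using reach_trans by metis
  qed
  moreover have "connected_graph V (insert e (T' - {?f}))"
  proof (rule connected_graph_replace_edge[OF T'(2)])
    let ?H = "insert e (T' - {?f})"
    show "T' \<subseteq> insert {x, y} ?H" by auto
    \<comment> \<open>By minimality, \<open>P\<close> without \<open>?f\<close> no longer joins
      \<open>u\<close> to \<open>v\<close>. Hence one end of \<open>?f\<close> stays joined to
      \<open>u\<close>, the other to \<open>v\<close>, and \<open>e\<close> links them.\<close>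
    have "(u, v) \<notin> reach (P - {?f})"
    proof
      assume "(u, v) \<in> reach (P - {?f})"
      then have "P - {?f} \<in> C" using P(1) by (auto simp: C_def)
      with Pmin xy(1) show False by blast
    qed
    then have "(u, x) \<in> reach (P - {?f}) \<and> (y, v) \<in> reach (P - {?f}) \<or>
        (u, y) \<in> reach (P - {?f}) \<and> (x, v) \<in> reach (P - {?f})"
      using reach_delete_edge_cases[OF P(2)] by blast
    moreover have "P - {?f} \<subseteq> ?H" using P by blast
    ultimately have "(u, x) \<in> reach ?H \<and> (y, v) \<in> reach ?H \<or> (u, y) \<in> reach ?H \<and> (x, v) \<in> reach ?H"
      using reach_mono[of "P - {?f}" ?H] by blast
    moreover have "(u, v) \<in> reach ?H" using uv by (intro reach_edge) simp
    ultimately show "(x, y) \<in> reach ?H" using reach_sym reach_trans by metis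
  qed
  ultimately show ?thesis by (rule that)
qed

lemma card_exchange:
  assumes "finite A" "f \<in> A" "e \<notin> A"
  shows "card (insert e (A - {f})) = card A"
  using assms by (metis Diff_iff card.remove card_insert_disjoint finite_Diff)

text \<open>Edges of \<open>T\<close> missing from \<open>U\<close> are exchanged into
  \<open>U\<close>, one at a time, for edges outside \<open>T\<close>. Size and connectedness
  persist until \<open>U\<close> contains \<open>T\<close>.\<close>

lemma spanning_tree_card_le:
  assumes G: "simple_graph V G" and T: "T \<in> spanning_trees V G"
    and "U \<subseteq> G" "connected_graph V U"
  shows "card T \<le> card U"
  using assms(3,4)
proof (induction "card (T - U)" arbitrary: U rule: less_induct)
  case less
  have TG: "T \<subseteq> G" using T by (simp add: spanning_trees_def)
  have fin: "finite T" "finite U"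
    using simple_graph_finite[OF G] TG less.prems by (auto intro: finite_subset)
  show ?case
  proof (cases "T \<subseteq> U")
    case True
    with fin show ?thesis by (simp add: card_mono)
  next
    case False
    then obtain e where e: "e \<in> T" "e \<notin> U" by blast
    obtain f where f: "f \<in> U" "f \<notin> T" "connected_graph V (insert e (U - {f}))"
      using connected_graph_exchange[OF G T less.prems e] by blast
    have "card (T - insert e (U - {f})) < card (T - U)"
      using e f fin by (intro psubset_card_mono) auto
    then have "card T \<le> card (insert e (U - {f}))"
      using less.hyps[of "insert e (U - {f})"] f e TG less.prems by auto
    then show ?thesis using card_exchange e f fin by metis
  qed
qed

text \<open>If \<open>U\<close> stayed connected without some edge, it would contain a connected
  graph with fewer edges than \<open>T\<close>, against the size bound.\<close>

lemma spanning_treeI_card: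
  assumes G: "simple_graph V G" and T: "T \<in> spanning_trees V G"
    and U: "U \<subseteq> G" "connected_graph V U" "card U = card T"
  shows "U \<in> spanning_trees V G"
proof -
  have "\<not> connected_graph V (U - {e})" if "e \<in> U" for e
  proof
    assume "connected_graph V (U - {e})"
    then have "card T \<le> card (U - {e})"
      using spanning_tree_card_le[OF G T, of "U - {e}"] U by blast
    moreover have "card (U - {e}) < card U"
      using that finite_subset[OF U(1) simple_graph_finite[OF G]] by (rule card_Diff1_less[rotated])
    ultimately show False using U by simp
  qed
  with U show ?thesis by (simp add: spanning_trees_iff[OF G])
qed

text \<open>Both exchanged graphs are connected and have as many edges as a tree. One
  \<open>f\<close> serves both exchanges, which the local optimality criterion depends on.\<close>

lemma spanning_tree_exchange:
  assumes G: "simple_graph V G" and T: "T \<in> spanning_trees V G" and T': "T' \<in> spanning_trees V G"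
    and e: "e \<in> T" "e \<notin> T'"
  obtains f where "f \<in> T'" "f \<notin> T"
    "insert f (T - {e}) \<in> spanning_trees V G" "insert e (T' - {f}) \<in> spanning_trees V G"
proof -
  have sub: "T \<subseteq> G" "T' \<subseteq> G" "connected_graph V T'"
    using T T' by (auto simp: spanning_trees_def)
  have fin: "finite T" "finite T'"
    using simple_graph_finite[OF G] sub by (auto intro: finite_subset)
  obtain f where f: "f \<in> T'" "f \<notin> T"
    "connected_graph V (insert f (T - {e}))" "connected_graph V (insert e (T' - {f}))"
    using connected_graph_exchange[OF G T sub(2,3) e] .
  have "insert f (T - {e}) \<in> spanning_trees V G"
    using f sub e fin by (intro spanning_treeI_card[OF G T] card_exchange) auto
  moreover have "insert e (T' - {f}) \<in> spanning_trees V G"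
    using f sub e fin by (intro spanning_treeI_card[OF G T'] card_exchange) auto
  ultimately show ?thesis using that f by blast
qed

section \<open>Single exchanges and optimality\<close>

lemma total_cost_exchange:
  assumes "finite A" "f \<in> A" "e \<notin> A"
  shows "total_cost c (insert e (A - {f})) = total_cost c A - c f + c e"
  using assms by (simp add: total_cost_def sum.remove[of A f])

text \<open>Move \<open>T'\<close> towards \<open>T\<close> by exchanges. The edge \<open>f\<close>
  leaving \<open>T'\<close> could also replace \<open>e\<close> in \<open>T\<close>, so
  \<open>c e \<le> c f\<close> and the cost of \<open>T'\<close> does not grow on the way to
  \<open>T\<close>.\<close>

lemma optimal_spanning_treeI:
  assumes G: "simple_graph V G" and T: "T \<in> spanning_trees V G"
    and local_opt: "\<And>e f. \<lbrakk>e \<in> T; f \<notin> T; insert f (T - {e}) \<in> spanning_trees V G\<rbrakk> \<Longrightarrow> c e \<le> c f"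
  shows "T \<in> optimal_solutions (spanning_trees V G) c"
proof -
  have "total_cost c T \<le> total_cost c T'" if "T' \<in> spanning_trees V G" for T'
    using that
  proof (induction "card (T - T')" arbitrary: T' rule: less_induct)
    case less
    have sub: "T \<subseteq> G" "T' \<subseteq> G" "connected_graph V T"
      using T less.prems by (auto simp: spanning_trees_def)
    have fin: "finite T" "finite T'"
      using simple_graph_finite[OF G] sub by (auto intro: finite_subset)
    show ?case
    proof (cases "T \<subseteq> T'")
      case True
      moreover have "card T' \<le> card T"
        using spanning_tree_card_le[OF G less.prems sub(1,3)] .
      ultimately have "T = T'" using fin by (simp add: card_seteq)
      then show ?thesis by simp
    next
      case False
      then obtain e where e: "e \<in> T" "e \<notin> T'" by blast
      obtain f where f: "f \<in> T'" "f \<notin> T"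
        "insert f (T - {e}) \<in> spanning_trees V G" "insert e (T' - {f}) \<in> spanning_trees V G"
        using spanning_tree_exchange[OF G T less.prems e] .
      have "card (T - insert e (T' - {f})) < card (T - T')"
        using e f fin by (intro psubset_card_mono) auto
      then have "total_cost c T \<le> total_cost c (insert e (T' - {f}))"
        using f(4) by (rule less.hyps)
      also have "\<dots> = total_cost c T' - c f + c e"
        by (rule total_cost_exchange[OF fin(2) f(1) e(2)])
      also have "\<dots> \<le> total_cost c T'"
        using local_opt[OF e(1) f(2,3)] by simp
      finally show ?thesis .
    qed
  qed
  with T show ?thesis by (simp add: optimal_solutions_def)
qed

section \<open>Tolerance sets\<close>

text \<open>Single tolerances become the case of a singleton \<open>E\<close>, so that attainment of
  the maximum is proved once for both kinds.\<close>

definition tolerances :: "'e set set \<Rightarrow> ('e \<Rightarrow> real) \<Rightarrow> 'e set \<Rightarrow> real set" where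
  "tolerances D c E = {\<alpha>. \<forall>S\<in>optimal_solutions D c. \<exists>\<alpha>s.
        (\<forall>e\<in>E. 0 \<le> \<alpha>s e) \<and> \<alpha> = (\<Sum>e\<in>E. \<alpha>s e) \<and>
        S \<in> optimal_solutions D (raise_costs c E \<alpha>s)}"

lemma set_upper_tolerance_eq: "set_upper_tolerance D c E = max_or_infinity (tolerances D c E)"
  by (simp add: set_upper_tolerance_def tolerances_def)

lemma raise_costs_singleton: "raise_costs c {e} \<alpha>s = c(e := c e + \<alpha>s e)"
  by (auto simp: raise_costs_def)

text \<open>If there is no optimal solution, the set on the right has no negative elements while
  \<open>tolerances D c {e}\<close> is everything.\<close>

lemma single_tolerances_eq:
  assumes "optimal_solutions D c \<noteq> {}"
  shows "{\<alpha>. 0 \<le> \<alpha> \<and> (\<forall>S\<in>optimal_solutions D c. S \<in> optimal_solutions D (c(e := c e + \<alpha>)))}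
    = tolerances D c {e}"
proof -
  have "(\<exists>\<alpha>s. 0 \<le> \<alpha>s e \<and> \<alpha> = \<alpha>s e \<and> S \<in> optimal_solutions D (c(e := c e + \<alpha>s e))) \<longleftrightarrow>
      0 \<le> \<alpha> \<and> S \<in> optimal_solutions D (c(e := c e + \<alpha>))" for \<alpha> :: real and S
    by (auto intro: exI[of _ "\<lambda>_. \<alpha>"])
  then show ?thesis using assms by (auto simp: tolerances_def raise_costs_singleton)
qed

lemma upper_tolerance_eq:
  assumes "optimal_solutions D c \<noteq> {}"
  shows "upper_tolerance D c e = max_or_infinity (tolerances D c {e})"
  by (simp add: upper_tolerance_def single_tolerances_eq[OF assms])

lemma zero_in_tolerances: "0 \<in> tolerances D c E"
proof -
  have "raise_costs c E (\<lambda>_. 0) = c" by (auto simp: raise_costs_def)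
  then show ?thesis by (auto simp: tolerances_def intro!: exI[of _ "\<lambda>_. 0"])
qed

text \<open>Vectors on \<open>F\<close> are extended by zero. This passes boundedness from
  \<open>E\<close> down to its single edges.\<close>

lemma tolerances_mono:
  assumes "finite E" "F \<subseteq> E"
  shows "tolerances D c F \<subseteq> tolerances D c E"
proof
  fix \<alpha> assume \<alpha>: "\<alpha> \<in> tolerances D c F"
  show "\<alpha> \<in> tolerances D c E"
    unfolding tolerances_def
  proof safe
    fix S assume "S \<in> optimal_solutions D c"
    with \<alpha> obtain \<alpha>s where as: "\<forall>e\<in>F. 0 \<le> \<alpha>s e" "\<alpha> = (\<Sum>e\<in>F. \<alpha>s e)"
      "S \<in> optimal_solutions D (raise_costs c F \<alpha>s)"
      by (auto simp: tolerances_def)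
    define \<beta> where "\<beta> = (\<lambda>e. if e \<in> F then \<alpha>s e else 0)"
    have "raise_costs c E \<beta> = raise_costs c F \<alpha>s"
      using assms by (auto simp: raise_costs_def \<beta>_def fun_eq_iff)
    moreover have "\<alpha> = (\<Sum>e\<in>E. \<beta> e)"
      using as assms unfolding \<beta>_def by (simp add: sum.inter_restrict[symmetric] Int_absorb1)
    ultimately show "\<exists>\<alpha>s. (\<forall>e\<in>E. 0 \<le> \<alpha>s e) \<and> \<alpha> = sum \<alpha>s E \<and>
        S \<in> optimal_solutions D (raise_costs c E \<alpha>s)"
      using as by (intro exI[of _ \<beta>]) (auto simp: \<beta>_def)
  qed
qed

section \<open>Attainment of the maximum\<close>

lemma closed_optimal_raises: "closed {\<alpha>s. S \<in> optimal_solutions D (raise_costs c E \<alpha>s)}"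
proof -
  have cont: "continuous_on UNIV (\<lambda>\<alpha>s. total_cost (raise_costs c E \<alpha>s) A)" for A
  proof -
    have "continuous_on UNIV (\<lambda>\<alpha>s. raise_costs c E \<alpha>s x)" for x
      by (cases "x \<in> E") (auto simp: raise_costs_def intro!: continuous_intros)
    then show ?thesis unfolding total_cost_def by (intro continuous_on_sum)
  qed
  \<comment> \<open>The first set is empty or everything; each of the others compares two costs that
    are continuous in the vector.\<close>
  have "{\<alpha>s. S \<in> optimal_solutions D (raise_costs c E \<alpha>s)} =
      {\<alpha>s. S \<in> D} \<inter> (\<Inter>A\<in>D. {\<alpha>s. total_cost (raise_costs c E \<alpha>s) S \<le> total_cost (raise_costs c E \<alpha>s) A})"
    by (auto simp: optimal_solutions_def)
  then show ?thesis
    by (auto intro!: closed_Int closed_INT closed_Collect_le cont)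
qed

text \<open>The set is the image, under the continuous sum, of a compact set of vectors. The cut at
  \<open>M\<close> is there because a single solution may tolerate arbitrarily large raises.\<close>

lemma compact_tolerances_of_solution:
  fixes E :: "'e set"
  assumes "finite E"
  shows "compact {\<alpha>. \<alpha> \<le> M \<and> (\<exists>\<alpha>s. (\<forall>e\<in>E. 0 \<le> \<alpha>s e) \<and> \<alpha> = (\<Sum>e\<in>E. \<alpha>s e) \<and>
        S \<in> optimal_solutions D (raise_costs c E \<alpha>s))}" (is "compact ?B")
proof -
  \<comment> \<open>Coordinates outside \<open>E\<close> are pinned to 0, so every factor is compact
    and Tychonoff's theorem applies in the full function space.\<close>
  let ?box = "Pi\<^sub>E UNIV (\<lambda>e. if e \<in> E then {0..M} else {0})"
  let ?O = "{\<alpha>s. S \<in> optimal_solutions D (raise_costs c E \<alpha>s)}"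
  let ?s = "\<lambda>\<alpha>s. \<Sum>e\<in>E. \<alpha>s e"
  let ?K = "?box \<inter> (?O \<inter> {\<alpha>s. ?s \<alpha>s \<le> M})"
  have cs: "continuous_on A ?s" for A :: "('e \<Rightarrow> real) set"
    by (intro continuous_on_sum continuous_on_subset[OF continuous_on_product_coordinates]) auto
  have "compactin (product_topology (\<lambda>_. euclidean) UNIV) ?box"
    by (auto simp: compactin_PiE)
  then have "compact ?box" by (simp add: euclidean_product_topology)
  moreover have "closed (?O \<inter> {\<alpha>s. ?s \<alpha>s \<le> M})"
    by (intro closed_Int closed_optimal_raises closed_Collect_le cs continuous_on_const)
  ultimately have "compact ?K" by (rule compact_Int_closed)
  then have "compact (?s ` ?K)" by (intro compact_continuous_image cs)
  moreover have "?s ` ?K = ?B"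
  proof (intro equalityI subsetI)
    fix \<alpha> assume "\<alpha> \<in> ?s ` ?K"
    then obtain \<alpha>s where K: "\<alpha>s \<in> ?K" and \<alpha>: "\<alpha> = ?s \<alpha>s" by (rule imageE)
    have "0 \<le> \<alpha>s e" if "e \<in> E" for e
      using PiE_mem[OF IntD1[OF K], of e] that by simp
    moreover have "S \<in> optimal_solutions D (raise_costs c E \<alpha>s)" "\<alpha> \<le> M"
      using K \<alpha> by simp_all
    ultimately show "\<alpha> \<in> ?B" using \<alpha> by auto
  next
    fix \<alpha> assume "\<alpha> \<in> ?B"
    then obtain \<alpha>s where as: "\<alpha> \<le> M" "\<forall>e\<in>E. 0 \<le> \<alpha>s e" "\<alpha> = ?s \<alpha>s"
      "S \<in> optimal_solutions D (raise_costs c E \<alpha>s)" by blast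
    \<comment> \<open>Resetting the values outside \<open>E\<close> moves the vector into the box
      and changes neither its sum over \<open>E\<close> nor the raised costs.\<close>
    define \<beta> where "\<beta> = (\<lambda>e. if e \<in> E then \<alpha>s e else 0)"
    have "raise_costs c E \<beta> = raise_costs c E \<alpha>s" by (auto simp: raise_costs_def \<beta>_def)
    moreover have "?s \<beta> = \<alpha>" using as by (simp add: \<beta>_def)
    moreover have "\<alpha>s e \<le> M" if "e \<in> E" for e
      using member_le_sum[of e E \<alpha>s] that as assms by auto
    ultimately have "\<beta> \<in> ?K" using as by (auto simp: PiE_iff \<beta>_def)
    with \<open>?s \<beta> = \<alpha>\<close>[symmetric] show "\<alpha> \<in> ?s ` ?K" by (rule image_eqI)
  qed
  ultimately show ?thesis by simp
qed

text \<open>The set is an intersection of compact sets, one for each optimal solution. The bound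
  \<open>M\<close> holds for the intersection, and each factor is cut at it.\<close>

lemma Greatest_tolerance:
  assumes "finite E" "optimal_solutions D c \<noteq> {}" "bdd_above (tolerances D c E)"
  shows "(GREATEST \<alpha>. \<alpha> \<in> tolerances D c E) \<in> tolerances D c E"
    and "\<alpha> \<in> tolerances D c E \<Longrightarrow> \<alpha> \<le> (GREATEST \<alpha>. \<alpha> \<in> tolerances D c E)"
proof -
  obtain M where M: "\<And>\<alpha>. \<alpha> \<in> tolerances D c E \<Longrightarrow> \<alpha> \<le> M"
    using assms(3) by (auto simp: bdd_above_def)
  define B where "B S = {\<alpha>. \<alpha> \<le> M \<and> (\<exists>\<alpha>s. (\<forall>e\<in>E. 0 \<le> \<alpha>s e) \<and> \<alpha> = (\<Sum>e\<in>E. \<alpha>s e) \<and>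
      S \<in> optimal_solutions D (raise_costs c E \<alpha>s))}" for S
  have B: "compact (B S)" for S
    unfolding B_def by (rule compact_tolerances_of_solution[OF assms(1)])
  obtain S0 where S0: "S0 \<in> optimal_solutions D c" using assms(2) by blast
  have "tolerances D c E = (\<Inter>S\<in>optimal_solutions D c. B S)"
  proof (intro equalityI subsetI)
    fix \<alpha> assume "\<alpha> \<in> tolerances D c E"
    with M[OF this] show "\<alpha> \<in> (\<Inter>S\<in>optimal_solutions D c. B S)"
      by (simp add: tolerances_def B_def)
  qed (simp add: tolerances_def B_def)
  \<comment> \<open>One factor is split off to supply compactness; the remaining intersection only
    has to be closed.\<close>
  also have "\<dots> = B S0 \<inter> (\<Inter>S\<in>optimal_solutions D c. B S)"
    using S0 by blast
  also have "compact \<dots>"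
    using B by (intro compact_Int_closed closed_INT ballI compact_imp_closed)
  finally have "compact (tolerances D c E)" .
  moreover have "tolerances D c E \<noteq> {}" using zero_in_tolerances by blast
  ultimately obtain m where m: "m \<in> tolerances D c E" "\<And>\<alpha>. \<alpha> \<in> tolerances D c E \<Longrightarrow> \<alpha> \<le> m"
    using compact_attains_sup[of "tolerances D c E"] by metis
  have eq: "(GREATEST \<alpha>. \<alpha> \<in> tolerances D c E) = m"
    by (rule Greatest_equality) (use m in auto)
  show "(GREATEST \<alpha>. \<alpha> \<in> tolerances D c E) \<in> tolerances D c E"
    and "\<alpha> \<in> tolerances D c E \<Longrightarrow> \<alpha> \<le> (GREATEST \<alpha>. \<alpha> \<in> tolerances D c E)"
    using m by (simp_all add: eq)
qed

section \<open>Raising by all single tolerances at once\<close>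

lemma sum_tolerances:
  assumes G: "simple_graph V G" and ne: "optimal_solutions (spanning_trees V G) c \<noteq> {}"
    and u: "\<And>e. e \<in> E \<Longrightarrow> u e \<in> tolerances (spanning_trees V G) c {e}"
  shows "(\<Sum>e\<in>E. u e) \<in> tolerances (spanning_trees V G) c E"
  unfolding tolerances_def
proof safe
  let ?D = "spanning_trees V G"
  have u_opt: "0 \<le> u e" "\<And>S. S \<in> optimal_solutions ?D c \<Longrightarrow> S \<in> optimal_solutions ?D (c(e := c e + u e))"
    if "e \<in> E" for e
    using u[OF that, folded single_tolerances_eq[OF ne]] by auto
  fix T assume T: "T \<in> optimal_solutions ?D c"
  then have TD: "T \<in> ?D" by (simp add: optimal_solutions_def)
  have fin: "finite T"
    using TD simple_graph_finite[OF G] by (auto simp: spanning_trees_def intro: finite_subset)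
  have exchange: "c' e \<le> c' f"
    if "T \<in> optimal_solutions ?D c'" "e \<in> T" "f \<notin> T" "insert f (T - {e}) \<in> ?D" for c' e f
  proof -
    have "total_cost c' T \<le> total_cost c' (insert f (T - {e}))"
      using that by (simp add: optimal_solutions_def)
    then show ?thesis using total_cost_exchange[OF fin that(2,3), of c'] by simp
  qed
  have opt: "T \<in> optimal_solutions ?D (raise_costs c E u)"
  proof (rule optimal_spanning_treeI[OF G TD])
    fix e f assume ef: "e \<in> T" "f \<notin> T" "insert f (T - {e}) \<in> ?D"
    \<comment> \<open>This keeps the cost of \<open>f\<close> at \<open>c f\<close> when only
      \<open>e\<close> is raised.\<close>
    have "e \<noteq> f" using ef by auto
    have "raise_costs c E u e \<le> c f"
    proof (cases "e \<in> E")
      case True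
      then show ?thesis
        using exchange[OF u_opt(2)[OF True T] ef] \<open>e \<noteq> f\<close> by (simp add: raise_costs_def)
    next
      case False
      then show ?thesis using exchange[OF T ef] by (simp add: raise_costs_def)
    qed
    also have "\<dots> \<le> raise_costs c E u f" using u_opt(1) by (simp add: raise_costs_def)
    finally show "raise_costs c E u e \<le> raise_costs c E u f" .
  qed
  show "\<exists>\<alpha>s. (\<forall>e\<in>E. 0 \<le> \<alpha>s e) \<and> sum u E = sum \<alpha>s E \<and>
      T \<in> optimal_solutions ?D (raise_costs c E \<alpha>s)"
    by (intro exI[of _ u] conjI ballI refl u_opt(1) opt)
qed

theorem theorem18:
  fixes V :: "'v set" and G :: "'v set set" and c :: "'v set \<Rightarrow> real" and E :: "'v set set"
  assumes "simple_graph V G"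
    and "connected_graph V G"
    and "E \<subseteq> G"
  shows "(\<Sum>e\<in>E. upper_tolerance (spanning_trees V G) c e)
           \<le> set_upper_tolerance (spanning_trees V G) c E"
proof (cases "bdd_above (tolerances (spanning_trees V G) c E)")
  case False
  then show ?thesis by (simp add: set_upper_tolerance_eq max_or_infinity_def)
next
  let ?A = "tolerances (spanning_trees V G) c"
  let ?u = "\<lambda>e. GREATEST \<alpha>. \<alpha> \<in> ?A {e}"
  case True
  \<comment> \<open>Without optimal solutions the defining condition would be vacuous and the set
    the whole real line, against its bound.\<close>
  have ne: "optimal_solutions (spanning_trees V G) c \<noteq> {}"
  proof
    assume "optimal_solutions (spanning_trees V G) c = {}"
    then have "?A E = UNIV" by (simp add: tolerances_def)
    moreover obtain M where "\<And>\<alpha>. \<alpha> \<in> ?A E \<Longrightarrow> \<alpha> \<le> M"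
      using True by (auto simp: bdd_above_def)
    ultimately have "M + 1 \<le> M" by blast
    then show False by simp
  qed
  have fin: "finite E"
    using assms simple_graph_finite finite_subset by metis
  \<comment> \<open>Hence every single tolerance is finite, and the claim becomes an inequality
    between reals.\<close>
  have bdd: "bdd_above (?A {e})" if "e \<in> E" for e
    using bdd_above_mono[OF True tolerances_mono[OF fin]] that by simp
  have "(\<Sum>e\<in>E. ?u e) \<in> ?A E"
    using sum_tolerances[OF assms(1) ne] Greatest_tolerance(1)[OF _ ne bdd] by simp
  then have "(\<Sum>e\<in>E. ?u e) \<le> (GREATEST \<alpha>. \<alpha> \<in> ?A E)"
    by (rule Greatest_tolerance(2)[OF fin ne True])
  moreover have "(\<Sum>e\<in>E. upper_tolerance (spanning_trees V G) c e) = (\<Sum>e\<in>E. ereal (?u e))"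
    using bdd by (intro sum.cong) (auto simp: upper_tolerance_eq[OF ne] max_or_infinity_def)
  ultimately show ?thesis
    using True by (simp add: set_upper_tolerance_eq max_or_infinity_def)
qed

end
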